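(* Let $n\ge1$ and let $\mathcal{H}_n$ be the Hecke algebra of $S_n$ with standard generators $T_i$ $(1\le i\le n-1)$. Put $\mathcal{T}_i := T_i+T_i^{-1}=2T_i-\varepsilon$. Then $\mathcal{H}_n$ has a presentation as a $\mathbb{C}(q)$-algebra with generators $\mathcal{T}_i$ $(1\le i\le n-1)$ subject to the relations $$\mathcal{T}_i^2 = q^2 +q^{-2} +2,$$ $$\mathcal{T}_i \mathcal{T}_j = \mathcal{T}_j \mathcal{T}_i \quad (|i-j|>1),$$ $$\mathcal{T}_i \mathcal{T}_{i+1} \mathcal{T}_i - \mathcal{T}_{i+1} \mathcal{T}_i \mathcal{T}_{i+1} = \varepsilon^2 (\mathcal{T}_{i+1} -\mathcal{T}_i).$$
   Context: Let $q$ be a formal parameter and $\varepsilon=q-q^{-1}$. The Hecke algebra $\mathcal{H}_n$ is the unital associative $\mathbb{C}(q)$-algebra generated by $T_i$ $(1\le i\le n-1)$ subject to: $(T_i-q)(T_i+q^{-1})=0$; $T_iT_{i+1}T_i=T_{i+1}T_iT_{i+1}$; $T_iT_j=T_jT_i$ for $|i-j|>1$. *)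

theory Defs
  imports
    "HOL-Algebra.Algebraic_Closure_Type"
    "HOL-Library.Poly_Mapping"
    "HOL-Computational_Algebra.Polynomial"
    "HOL-Computational_Algebra.Fraction_Field"
begin

text \<open>HOL-Algebra's \<open>algebra\<close> is commutative; this is its version without commutativity.\<close>

locale assoc_algebra = module R M + ring M
  for R :: "('k, 'c) ring_scheme" (structure)
    and M :: "('k, 'a, 'd) module_scheme" (structure) +
  assumes smult_assoc_left:
      "\<lbrakk>c \<in> carrier R; x \<in> carrier M; y \<in> carrier M\<rbrakk> \<Longrightarrow>
        (c \<odot>\<^bsub>M\<^esub> x) \<otimes>\<^bsub>M\<^esub> y = c \<odot>\<^bsub>M\<^esub> (x \<otimes>\<^bsub>M\<^esub> y)"
    and smult_assoc_right:
      "\<lbrakk>c \<in> carrier R; x \<in> carrier M; y \<in> carrier M\<rbrakk> \<Longrightarrow>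
        x \<otimes>\<^bsub>M\<^esub> (c \<odot>\<^bsub>M\<^esub> y) = c \<odot>\<^bsub>M\<^esub> (x \<otimes>\<^bsub>M\<^esub> y)"

definition algebra_iso ::
    "('k, 'c) ring_scheme \<Rightarrow> ('k, 'a, 'd) module_scheme \<Rightarrow> ('k, 'b, 'e) module_scheme \<Rightarrow> ('a \<Rightarrow> 'b) set"
  where "algebra_iso R A B =
    {h \<in> ring_iso A B. \<forall>c \<in> carrier R. \<forall>x \<in> carrier A. h (c \<odot>\<^bsub>A\<^esub> x) = c \<odot>\<^bsub>B\<^esub> h x}"

definition quotient_algebra :: "('k, 'a) module \<Rightarrow> 'a set \<Rightarrow> ('k, 'a set) module"
  where "quotient_algebra A J =
    \<lparr>carrier = carrier (A Quot J), monoid.mult = monoid.mult (A Quot J), one = one (A Quot J),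
      zero = ring.zero (A Quot J), add = ring.add (A Quot J),
      module.smult = (\<lambda>c U. \<Union>u\<in>U. J +>\<^bsub>A\<^esub> (c \<odot>\<^bsub>A\<^esub> u))\<rparr>"

text \<open>
  Words form the free monoid under concatenation.  It is written additively because the
  multiplication of \<^type>\<open>poly_mapping\<close> is convolution over an additive (here noncommutative)
  monoid.  Hence \<open>'i word \<Rightarrow>\<^sub>0 'k\<close> is the free associative algebra on the type \<open>'i\<close>.
\<close>

datatype 'i word = Word (letters: "'i list")

instantiation word :: (type) monoid_add
begin

definition zero_word :: "'i word" where "zero_word = Word []"

definition plus_word :: "'i word \<Rightarrow> 'i word \<Rightarrow> 'i word"
  where "plus_word v w = Word (letters v @ letters w)"

instance by standard (simp_all add: zero_word_def plus_word_def)

end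

definition fa_gen :: "'i \<Rightarrow> 'i word \<Rightarrow>\<^sub>0 'k::field"
  where "fa_gen i = Poly_Mapping.single (Word [i]) 1"

definition fa_const :: "'k \<Rightarrow> 'i word \<Rightarrow>\<^sub>0 'k::field"
  where "fa_const c = Poly_Mapping.single 0 c"

definition free_algebra :: "'i set \<Rightarrow> ('k::field, 'i word \<Rightarrow>\<^sub>0 'k) module"
  where "free_algebra I =
    \<lparr>carrier = {p. \<forall>w \<in> Poly_Mapping.keys p. set (letters w) \<subseteq> I},
      monoid.mult = (*), one = 1, zero = 0, add = (+), module.smult = (\<lambda>c p. fa_const c * p)\<rparr>"

text \<open>A pair \<open>(l, r)\<close> in a set of relations stands for the relation \<open>l = r\<close>.\<close>

type_synonym ('i, 'k) relations = "(('i word \<Rightarrow>\<^sub>0 'k) \<times> ('i word \<Rightarrow>\<^sub>0 'k)) set"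

definition relation_ideal :: "'i set \<Rightarrow> ('i, 'k::field) relations \<Rightarrow> ('i word \<Rightarrow>\<^sub>0 'k) set"
  where "relation_ideal I Rel = Idl\<^bsub>free_algebra I\<^esub> ((\<lambda>(l, r). l - r) ` Rel)"

definition presented_algebra ::
    "'i set \<Rightarrow> ('i, 'k::field) relations \<Rightarrow> ('k, ('i word \<Rightarrow>\<^sub>0 'k) set) module"
  where "presented_algebra I Rel = quotient_algebra (free_algebra I) (relation_ideal I Rel)"

definition presented_gen ::
    "'i set \<Rightarrow> ('i, 'k::field) relations \<Rightarrow> 'i \<Rightarrow> ('i word \<Rightarrow>\<^sub>0 'k) set"
  where "presented_gen I Rel i = relation_ideal I Rel +>\<^bsub>free_algebra I\<^esub> fa_gen i"

definition has_presentation ::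
    "('k::field, 'a) module \<Rightarrow> 'i set \<Rightarrow> ('i \<Rightarrow> 'a) \<Rightarrow> ('i, 'k) relations \<Rightarrow> bool"
  where "has_presentation A I x Rel \<longleftrightarrow>
    assoc_algebra ring_of_type_algebra A \<and>
    Rel \<subseteq> carrier (free_algebra I) \<times> carrier (free_algebra I) \<and>
    (\<exists>h \<in> algebra_iso ring_of_type_algebra (presented_algebra I Rel) A.
      \<forall>i \<in> I. h (presented_gen I Rel i) = x i)"


type_synonym Cq = "complex poly fract"

definition hecke_q :: Cq where "hecke_q = Fract [:0, 1:] 1"

definition hecke_eps :: Cq where "hecke_eps = hecke_q - inverse hecke_q"

definition hecke_relations :: "nat \<Rightarrow> (nat, Cq) relations"
  where "hecke_relations n =
    {((fa_gen i - fa_const hecke_q) * (fa_gen i + fa_const (inverse hecke_q)), 0) |i.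
      i \<in> {1..n - 1}} \<union>
    {(fa_gen i * fa_gen (i + 1) * fa_gen i, fa_gen (i + 1) * fa_gen i * fa_gen (i + 1)) |i.
      i \<in> {1..n - 1} \<and> i + 1 \<in> {1..n - 1}} \<union>
    {(fa_gen i * fa_gen j, fa_gen j * fa_gen i) |i j.
      i \<in> {1..n - 1} \<and> j \<in> {1..n - 1} \<and> \<bar>int i - int j\<bar> > 1}"

definition hecke_algebra :: "nat \<Rightarrow> (Cq, (nat word \<Rightarrow>\<^sub>0 Cq) set) module"
  where "hecke_algebra n = presented_algebra {1..n - 1} (hecke_relations n)"

definition hecke_T :: "nat \<Rightarrow> nat \<Rightarrow> (nat word \<Rightarrow>\<^sub>0 Cq) set"
  where "hecke_T n i = presented_gen {1..n - 1} (hecke_relations n) i"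

definition hecke_calT :: "nat \<Rightarrow> nat \<Rightarrow> (nat word \<Rightarrow>\<^sub>0 Cq) set"
  where "hecke_calT n i = hecke_T n i \<oplus>\<^bsub>hecke_algebra n\<^esub> inv\<^bsub>hecke_algebra n\<^esub> (hecke_T n i)"

definition calT_relations :: "nat \<Rightarrow> (nat, Cq) relations"
  where "calT_relations n =
    {((fa_gen i)\<^sup>2, fa_const (hecke_q\<^sup>2 + (inverse hecke_q)\<^sup>2 + 2)) |i.
      i \<in> {1..n - 1}} \<union>
    {(fa_gen i * fa_gen j, fa_gen j * fa_gen i) |i j.
      i \<in> {1..n - 1} \<and> j \<in> {1..n - 1} \<and> \<bar>int i - int j\<bar> > 1} \<union>
    {(fa_gen i * fa_gen (i + 1) * fa_gen i - fa_gen (i + 1) * fa_gen i * fa_gen (i + 1),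
      fa_const (hecke_eps\<^sup>2) * (fa_gen (i + 1) - fa_gen i)) |i.
      i \<in> {1..n - 1} \<and> i + 1 \<in> {1..n - 1}}"

end

theory Submission
  imports Defs
begin

text \<open>
  Write \<open>F\<close> for the free algebra on the index set and \<open>J\<close> for the ideal generated by the Hecke
  relations.  The quadratic relation \<open>(T - q) (T + q\<^sup>-\<^sup>1) = 0\<close> says \<open>T (T - \<epsilon>) = 1\<close>, so \<open>T\<close> is a unit
  with inverse \<open>T - \<epsilon>\<close>, and \<open>T + T\<^sup>-\<^sup>1 = 2 T - \<epsilon>\<close>.

  The affine substitution \<open>a \<mapsto> 2 a - \<epsilon>\<close> is invertible because 2 is a unit, with inverse
  \<open>x \<mapsto> (x + \<epsilon>) / 2\<close>.  A presentation may be transported along such an invertible substitution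
  (\<open>has_presentation_change_generators\<close>, a Tietze transformation) as soon as each of the two sets of
  relations is mapped into the ideal of the other.  Both inclusions come from the same three
  identities, valid for arbitrary elements \<open>a\<close>, \<open>b\<close> of \<open>F\<close> (\<open>calT_of_identities\<close>): with
  \<open>A = 2 a - \<epsilon>\<close>, \<open>B = 2 b - \<epsilon>\<close> and \<open>Q a = (a - q) (a + q\<^sup>-\<^sup>1)\<close>,

    \<^item> \<open>A\<^sup>2 - (q\<^sup>2 + q\<^sup>-\<^sup>2 + 2) = 4 Q a\<close>,
    \<^item> \<open>A B - B A = 4 (a b - b a)\<close>,
    \<^item> \<open>A B A - B A B - \<epsilon>\<^sup>2 (B - A) = 8 (a b a - b a b) - 4 \<epsilon> Q a + 4 \<epsilon> Q b\<close>.

  Hence, in any ideal of \<open>F\<close>, the relations for \<open>A\<close> and \<open>B\<close> hold exactly when those for \<open>a\<close> and \<open>b\<close>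
  do (\<open>calT_of_relations_iff\<close>).  Taking for \<open>a\<close> a generator gives one inclusion, and taking
  \<open>a = (x + \<epsilon>) / 2\<close> for a generator \<open>x\<close>, so that \<open>A = x\<close>, gives the other.
\<close>

section \<open>The free associative algebra\<close>

lemma mem_free_algebra:
  "p \<in> carrier (free_algebra I) \<longleftrightarrow> (\<forall>w \<in> Poly_Mapping.keys p. set (letters w) \<subseteq> I)"
  by (simp add: free_algebra_def)

lemma free_algebra_simps [simp]:
  "monoid.mult (free_algebra I) = (*)" "one (free_algebra I) = 1"
  "zero (free_algebra I) = 0" "add (free_algebra I) = (+)"
  "module.smult (free_algebra I) = (\<lambda>c p. fa_const c * p)"
  by (simp_all add: free_algebra_def)

lemma fa_const_simps [simp]: "fa_const 0 = 0" "fa_const 1 = 1"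
  by (simp_all add: fa_const_def)

lemma fa_const_hom:
  "fa_const (c + d) = fa_const c + fa_const d"
  "fa_const (c - d) = fa_const c - fa_const d"
  "fa_const (- c) = - fa_const c"
  "fa_const (c * d) = fa_const c * fa_const d"
  by (simp_all add: fa_const_def single_add single_diff single_uminus mult_single)

lemma poly_mapping_eq_sum_single:
  "p = (\<Sum>w\<in>Poly_Mapping.keys p. Poly_Mapping.single w (Poly_Mapping.lookup p w))"
  by (rule poly_mapping_eqI)
    (auto simp: lookup_sum lookup_single when_def in_keys_iff)

text \<open>
  Monomials are stated as \<open>Word xs\<close>, so that the last case can be treated by induction on the list
  of letters.
\<close>

lemma free_algebra_induct [consumes 1, case_names zero add single]:
  assumes p: "p \<in> carrier (free_algebra I)"
    and zero: "P 0"
    and add: "\<And>p q. P p \<Longrightarrow> P q \<Longrightarrow> P (p + q)"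
    and single: "\<And>xs c. set xs \<subseteq> I \<Longrightarrow> P (Poly_Mapping.single (Word xs) c)"
  shows "P p"
proof -
  have "P (\<Sum>w\<in>W. Poly_Mapping.single w (Poly_Mapping.lookup p w))"
    if "finite W" "W \<subseteq> Poly_Mapping.keys p" for W
    using that
  proof (induction W rule: finite_induct)
    case (insert w W)
    have "P (Poly_Mapping.single (Word (letters w)) (Poly_Mapping.lookup p w))"
      using insert.prems p by (intro single) (auto simp: mem_free_algebra)
    then show ?case using insert by (auto intro: add)
  qed (simp add: zero)
  from this[of "Poly_Mapping.keys p"] show ?thesis
    using poly_mapping_eq_sum_single[of p] by simp
qed

lemma free_algebra_UNIV: "p \<in> carrier (free_algebra UNIV)"
  by (simp add: mem_free_algebra)

lemma fa_const_commute: "fa_const c * p = p * fa_const c"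
  using free_algebra_UNIV[of p]
  by (induction p rule: free_algebra_induct)
    (simp_all add: fa_const_def mult_single ring_distribs mult.commute)

lemma free_algebra_closed [simp, intro]:
  "0 \<in> carrier (free_algebra I)" "1 \<in> carrier (free_algebra I)"
  "fa_const c \<in> carrier (free_algebra I)"
  "i \<in> I \<Longrightarrow> fa_gen i \<in> carrier (free_algebra I)"
  "p \<in> carrier (free_algebra I) \<Longrightarrow> - p \<in> carrier (free_algebra I)"
  "p \<in> carrier (free_algebra I) \<Longrightarrow> q \<in> carrier (free_algebra I) \<Longrightarrow>
    p + q \<in> carrier (free_algebra I)"
  "p \<in> carrier (free_algebra I) \<Longrightarrow> q \<in> carrier (free_algebra I) \<Longrightarrow>
    p - q \<in> carrier (free_algebra I)"
  "p \<in> carrier (free_algebra I) \<Longrightarrow> q \<in> carrier (free_algebra I) \<Longrightarrow>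
    p * q \<in> carrier (free_algebra I)"
proof -
  assume p: "p \<in> carrier (free_algebra I)" and q: "q \<in> carrier (free_algebra I)"
  show "p + q \<in> carrier (free_algebra I)"
    using p q keys_add[of p q] by (auto simp: mem_free_algebra)
  show "p - q \<in> carrier (free_algebra I)"
    using p q keys_diff[of p q] by (auto simp: mem_free_algebra)
  show "p * q \<in> carrier (free_algebra I)"
    using p q keys_mult[of p q] by (fastforce simp: mem_free_algebra plus_word_def)
qed (auto simp: mem_free_algebra fa_const_def fa_gen_def zero_word_def
    split: if_splits simp flip: single_one)

interpretation scalars: cring "ring_of_type_algebra :: 'k::field ring"
  by (rule cring_from_type_algebra)

lemma scalars_simps [simp]:
  "carrier (ring_of_type_algebra :: 'k::field ring) = UNIV"
  "monoid.mult (ring_of_type_algebra :: 'k::field ring) = (*)"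
  "one (ring_of_type_algebra :: 'k::field ring) = 1"
  "add (ring_of_type_algebra :: 'k::field ring) = (+)"
  by (simp_all add: ring_of_type_algebra_def)

lemma assoc_algebra_free_algebra:
  "assoc_algebra ring_of_type_algebra (free_algebra I :: ('k::field, 'i word \<Rightarrow>\<^sub>0 'k) module)"
proof -
  let ?F = "free_algebra I :: ('k, 'i word \<Rightarrow>\<^sub>0 'k) module"
  interpret F: ring ?F
  proof (rule ringI)
    show "abelian_group ?F"
    proof (rule abelian_groupI)
      fix p assume "p \<in> carrier ?F"
      then show "\<exists>q\<in>carrier ?F. q \<oplus>\<^bsub>?F\<^esub> p = \<zero>\<^bsub>?F\<^esub>"
        by (intro bexI[of _ "- p"]) auto
    qed (auto simp: algebra_simps)
    show "Group.monoid ?F"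
      by (rule monoidI) (auto simp: algebra_simps)
  qed (auto simp: algebra_simps)
  show ?thesis
  proof (intro assoc_algebra.intro assoc_algebra_axioms.intro moduleI)
    fix c :: 'k and x y :: "'i word \<Rightarrow>\<^sub>0 'k"
    show "x \<otimes>\<^bsub>?F\<^esub> (c \<odot>\<^bsub>?F\<^esub> y) = c \<odot>\<^bsub>?F\<^esub> (x \<otimes>\<^bsub>?F\<^esub> y)"
      by (simp add: fa_const_commute[of c x] flip: mult.assoc)
  qed (auto simp: fa_const_hom ring_distribs mult.assoc scalars.is_cring
      F.ring_axioms F.abelian_group_axioms)
qed

interpretation free: assoc_algebra ring_of_type_algebra
    "free_algebra I :: ('k::field, 'i word \<Rightarrow>\<^sub>0 'k) module" for I
  by (rule assoc_algebra_free_algebra)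

lemma free_algebra_minus [simp]:
  assumes "p \<in> carrier (free_algebra I)" "q \<in> carrier (free_algebra I)"
  shows "a_inv (free_algebra I) q = - q" "p \<ominus>\<^bsub>free_algebra I\<^esub> q = p - q"
proof -
  show *: "a_inv (free_algebra I) q = - q"
    using assms by (intro free.M.minus_equality) auto
  show "p \<ominus>\<^bsub>free_algebra I\<^esub> q = p - q" by (simp add: a_minus_def *)
qed

section \<open>Quotients of an algebra by a two-sided ideal\<close>

locale algebra_ideal = assoc_algebra R M + ideal J M
  for R :: "('k, 'c) ring_scheme" (structure)
    and M :: "('k, 'a) module" (structure)
    and J
begin

text \<open>
  A ring ideal of a unital algebra is automatically a submodule, because scaling by \<open>c\<close> is
  multiplication by \<open>c \<odot> \<one>\<close>.
\<close>

lemma smult_mem_ideal: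
  assumes "c \<in> carrier R" "x \<in> J"
  shows "c \<odot>\<^bsub>M\<^esub> x \<in> J"
proof -
  have "(c \<odot>\<^bsub>M\<^esub> \<one>\<^bsub>M\<^esub>) \<otimes>\<^bsub>M\<^esub> x \<in> J"
    using assms by (intro I_l_closed) auto
  then show ?thesis using assms by (simp add: smult_assoc_left)
qed

text \<open>
  The action on the quotient is defined as a union over all representatives of a coset; the members
  of this union coincide.
\<close>

lemma quotient_algebra_smult:
  assumes c: "c \<in> carrier R" and x: "x \<in> carrier M"
  shows "c \<odot>\<^bsub>quotient_algebra M J\<^esub> (J +>\<^bsub>M\<^esub> x) = J +>\<^bsub>M\<^esub> (c \<odot>\<^bsub>M\<^esub> x)"
proof -
  have "J +>\<^bsub>M\<^esub> (c \<odot>\<^bsub>M\<^esub> u) = J +>\<^bsub>M\<^esub> (c \<odot>\<^bsub>M\<^esub> x)" if u: "u \<in> J +>\<^bsub>M\<^esub> x" for u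
  proof -
    obtain j where j: "j \<in> J" and u_eq: "u = j \<oplus>\<^bsub>M\<^esub> x"
      using u unfolding a_r_coset_def' by blast
    have "c \<odot>\<^bsub>M\<^esub> u = c \<odot>\<^bsub>M\<^esub> j \<oplus>\<^bsub>M\<^esub> c \<odot>\<^bsub>M\<^esub> x"
      using c x j by (simp add: u_eq smult_r_distr)
    then have "c \<odot>\<^bsub>M\<^esub> u \<in> J +>\<^bsub>M\<^esub> (c \<odot>\<^bsub>M\<^esub> x)"
      using smult_mem_ideal[OF c j] by (auto simp: a_r_coset_def')
    then show ?thesis
      using c x by (intro a_repr_independence'[symmetric]) auto
  qed
  moreover have "x \<in> J +>\<^bsub>M\<^esub> x" using x by (rule a_rcos_self)
  ultimately have "(\<Union>u\<in>J +>\<^bsub>M\<^esub> x. J +>\<^bsub>M\<^esub> (c \<odot>\<^bsub>M\<^esub> u)) = J +>\<^bsub>M\<^esub> (c \<odot>\<^bsub>M\<^esub> x)"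
    by blast
  then show ?thesis by (simp add: quotient_algebra_def)
qed

lemma quotient_algebra_simps:
  "carrier (quotient_algebra M J) = (\<lambda>x. J +>\<^bsub>M\<^esub> x) ` carrier M"
  "\<one>\<^bsub>quotient_algebra M J\<^esub> = J +>\<^bsub>M\<^esub> \<one>\<^bsub>M\<^esub>"
  "\<zero>\<^bsub>quotient_algebra M J\<^esub> = J"
  "x \<in> carrier M \<Longrightarrow> y \<in> carrier M \<Longrightarrow>
    (J +>\<^bsub>M\<^esub> x) \<oplus>\<^bsub>quotient_algebra M J\<^esub> (J +>\<^bsub>M\<^esub> y) = J +>\<^bsub>M\<^esub> (x \<oplus>\<^bsub>M\<^esub> y)"
  "x \<in> carrier M \<Longrightarrow> y \<in> carrier M \<Longrightarrow>
    (J +>\<^bsub>M\<^esub> x) \<otimes>\<^bsub>quotient_algebra M J\<^esub> (J +>\<^bsub>M\<^esub> y) = J +>\<^bsub>M\<^esub> (x \<otimes>\<^bsub>M\<^esub> y)"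
  by (auto simp: quotient_algebra_def FactRing_def A_RCOSETS_def' rcoset_mult_add a_rcos_sum)

text \<open>
  \<^const>\<open>quotient_algebra\<close> and the quotient ring have the same operations but different record types,
  so ring properties are transported along the identity, which is a ring isomorphism between them.
\<close>

lemma ring_quotient_algebra: "ring (quotient_algebra M J)"
proof -
  interpret Q: ring "M Quot J" by (rule quotient_is_ring)
  have "id \<in> ring_iso (M Quot J) (quotient_algebra M J)"
    by (auto simp: ring_iso_def ring_hom_def quotient_algebra_def)
  from Q.ring_iso_imp_img_ring[OF this] show ?thesis
    by (simp add: quotient_algebra_def)
qed

lemma assoc_algebra_quotient_algebra: "assoc_algebra R (quotient_algebra M J)"
proof -
  interpret Q: ring "quotient_algebra M J" by (rule ring_quotient_algebra)
  show ?thesis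
    by (intro assoc_algebra.intro assoc_algebra_axioms.intro moduleI
        R.is_cring Q.abelian_group_axioms Q.ring_axioms)
      (auto simp: quotient_algebra_simps quotient_algebra_smult smult_l_distr smult_r_distr
        smult_assoc1 smult_assoc_left smult_assoc_right)
qed

lemma quotient_algebra_minus:
  assumes x: "x \<in> carrier M" and y: "y \<in> carrier M"
  shows "(J +>\<^bsub>M\<^esub> x) \<ominus>\<^bsub>quotient_algebra M J\<^esub> (J +>\<^bsub>M\<^esub> y) = J +>\<^bsub>M\<^esub> (x \<ominus>\<^bsub>M\<^esub> y)"
proof -
  interpret Q: ring "quotient_algebra M J" by (rule ring_quotient_algebra)
  have "(J +>\<^bsub>M\<^esub> (\<ominus>\<^bsub>M\<^esub> y)) \<oplus>\<^bsub>quotient_algebra M J\<^esub> (J +>\<^bsub>M\<^esub> y) = \<zero>\<^bsub>quotient_algebra M J\<^esub>"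
    using y a_rcos_const[OF zero_closed] by (simp add: quotient_algebra_simps M.l_neg)
  then have "a_inv (quotient_algebra M J) (J +>\<^bsub>M\<^esub> y) = J +>\<^bsub>M\<^esub> (\<ominus>\<^bsub>M\<^esub> y)"
    using y by (intro Q.minus_equality) (auto simp: quotient_algebra_simps)
  then show ?thesis
    using x y by (simp add: a_minus_def quotient_algebra_simps)
qed

lemma coset_eq_iff:
  assumes "x \<in> carrier M" "y \<in> carrier M"
  shows "J +>\<^bsub>M\<^esub> x = J +>\<^bsub>M\<^esub> y \<longleftrightarrow> x \<ominus>\<^bsub>M\<^esub> y \<in> J"
proof
  assume "J +>\<^bsub>M\<^esub> x = J +>\<^bsub>M\<^esub> y"
  then have "x \<in> J +>\<^bsub>M\<^esub> y" using a_rcos_self[OF assms(1)] by simp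
  then show "x \<ominus>\<^bsub>M\<^esub> y \<in> J" using a_rcos_module_minus[OF ring_axioms assms(2,1)] by simp
next
  assume "x \<ominus>\<^bsub>M\<^esub> y \<in> J"
  then have "x \<in> J +>\<^bsub>M\<^esub> y" using a_rcos_module_minus[OF ring_axioms assms(2,1)] by simp
  then show "J +>\<^bsub>M\<^esub> x = J +>\<^bsub>M\<^esub> y" using a_repr_independence' assms(2) by simp
qed

text \<open>
  The first isomorphism theorem for algebras.  The value of the isomorphism on cosets is part of the
  conclusion, since a presentation prescribes the images of the generators.
\<close>

lemma quotient_algebra_iso:
  assumes B: "ring B" and h: "h \<in> ring_hom M B"
    and smult: "\<And>c x. c \<in> carrier R \<Longrightarrow> x \<in> carrier M \<Longrightarrow> h (c \<odot>\<^bsub>M\<^esub> x) = c \<odot>\<^bsub>B\<^esub> h x"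
    and surj: "h ` carrier M = carrier B"
    and kernel: "{x \<in> carrier M. h x = \<zero>\<^bsub>B\<^esub>} = J"
  shows "\<exists>k \<in> algebra_iso R (quotient_algebra M J) B. \<forall>x \<in> carrier M. k (J +>\<^bsub>M\<^esub> x) = h x"
proof -
  have h_hom: "ring_hom_ring M B h"
    using ring_axioms B h by (rule ring_hom_ringI2)
  have ker: "a_kernel M B h = J"
    unfolding a_kernel_def' by (rule kernel)
  define k where "k = (\<lambda>U. the_elem (h ` U))"
  have k_coset: "k (J +>\<^bsub>M\<^esub> x) = h x" if "x \<in> carrier M" for x
    using ring_hom_ring.the_elem_simp[OF h_hom that] unfolding ker k_def .
  have "k \<in> ring_iso (M Quot J) B"
    using ring_hom_ring.FactRing_iso_set[OF h_hom surj] unfolding ker k_def .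
  then have "k \<in> ring_iso (quotient_algebra M J) B"
    by (simp add: ring_iso_def ring_hom_def quotient_algebra_def)
  then have "k \<in> algebra_iso R (quotient_algebra M J) B"
    by (auto simp: algebra_iso_def quotient_algebra_simps quotient_algebra_smult k_coset smult)
  with k_coset show ?thesis by blast
qed

end

section \<open>Substitution homomorphisms between free algebras\<close>

text \<open>
  For \<open>f\<close> with values in a free algebra, this is the algebra homomorphism given by the universal
  property of the free algebra.
\<close>

definition fa_subst ::
    "('i \<Rightarrow> 'j word \<Rightarrow>\<^sub>0 'k::field) \<Rightarrow> ('i word \<Rightarrow>\<^sub>0 'k) \<Rightarrow> 'j word \<Rightarrow>\<^sub>0 'k"
  where "fa_subst f p =
    (\<Sum>w\<in>Poly_Mapping.keys p.
      fa_const (Poly_Mapping.lookup p w) * prod_list (map f (letters w)))"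

lemma fa_subst_single:
  "fa_subst f (Poly_Mapping.single w c) = fa_const c * prod_list (map f (letters w))"
  by (simp add: fa_subst_def)

lemma fa_subst_zero [simp]: "fa_subst f 0 = 0"
  by (simp add: fa_subst_def)

lemma fa_subst_fa_const [simp]: "fa_subst f (fa_const c) = fa_const c"
  by (simp add: fa_const_def fa_subst_single zero_word_def)

lemma fa_subst_one [simp]: "fa_subst f 1 = 1"
  using fa_subst_fa_const[of f 1] by simp

lemma fa_subst_fa_gen [simp]: "fa_subst f (fa_gen i) = f i"
  by (simp add: fa_gen_def fa_subst_single)

lemma fa_subst_add [simp]: "fa_subst f (p + q) = fa_subst f p + fa_subst f q"
  unfolding fa_subst_def
  by (rule setsum_keys_plus_distrib) (simp_all add: fa_const_hom ring_distribs)

lemma fa_subst_diff [simp]: "fa_subst f (p - q) = fa_subst f p - fa_subst f q"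
  using fa_subst_add[of f "p - q" q] by simp

lemma fa_subst_mult [simp]:
  fixes f :: "'i \<Rightarrow> 'j word \<Rightarrow>\<^sub>0 'k::field"
  shows "fa_subst f (p * q) = fa_subst f p * fa_subst f q"
proof -
  have single: "fa_subst f (Poly_Mapping.single v c * q) =
      fa_subst f (Poly_Mapping.single v c) * fa_subst f q" for v c
    using free_algebra_UNIV[of q]
  proof (induction q rule: free_algebra_induct)
    case (single xs d)
    have "fa_const (c * d) * (P * Q) = fa_const c * P * (fa_const d * Q)"
      for P Q :: "'j word \<Rightarrow>\<^sub>0 'k"
      by (simp add: fa_const_hom mult.assoc fa_const_commute[of d "P * Q"]
          fa_const_commute[of d Q])
    then show ?case
      by (simp add: mult_single fa_subst_single plus_word_def)
  qed (simp_all add: ring_distribs)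
  show ?thesis
    using free_algebra_UNIV[of p]
    by (induction p rule: free_algebra_induct) (simp_all add: ring_distribs single)
qed

lemma fa_subst_power [simp]: "fa_subst f (p ^ m) = fa_subst f p ^ m"
  by (induction m) simp_all

lemma fa_subst_prod_list [simp]:
  "fa_subst f (prod_list ps) = prod_list (map (fa_subst f) ps)"
  by (induction ps) simp_all

lemma single_eq_prod_list:
  "Poly_Mapping.single (Word xs) c = fa_const c * prod_list (map fa_gen xs)"
proof (induction xs)
  case Nil
  then show ?case by (simp add: fa_const_def zero_word_def)
next
  case (Cons x xs)
  have "Poly_Mapping.single (Word (x # xs)) c = fa_gen x * Poly_Mapping.single (Word xs) c"
    by (simp add: fa_gen_def mult_single plus_word_def)
  then show ?case
    by (simp add: Cons fa_const_commute[of c] mult.assoc)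
qed

lemma fa_subst_closed:
  assumes p: "p \<in> carrier (free_algebra I)"
    and f: "\<And>i. i \<in> I \<Longrightarrow> f i \<in> carrier (free_algebra K)"
  shows "fa_subst f p \<in> carrier (free_algebra K)"
  using p
proof (induction p rule: free_algebra_induct)
  case (single xs c)
  then have "prod_list (map f xs) \<in> carrier (free_algebra K)"
    by (induction xs) (auto simp: f)
  then show ?case by (auto simp: fa_subst_single)
qed auto

lemma fa_subst_fa_subst: "fa_subst g (fa_subst f p) = fa_subst (\<lambda>i. fa_subst g (f i)) p"
  using free_algebra_UNIV[of p]
  by (induction p rule: free_algebra_induct) (simp_all add: fa_subst_single o_def)

lemma fa_subst_fa_gen_id: "fa_subst fa_gen p = p"
  using free_algebra_UNIV[of p]
  by (induction p rule: free_algebra_induct) (simp_all add: fa_subst_single single_eq_prod_list o_def)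

section \<open>Change of generators in a presentation\<close>

lemma algebra_ideal_free:
  "ideal J (free_algebra I) \<Longrightarrow> algebra_ideal ring_of_type_algebra (free_algebra I) J"
  by (simp add: algebra_ideal_def assoc_algebra_free_algebra)

lemma free_ideal_closed:
  assumes "ideal J (free_algebra I)"
  shows "0 \<in> J" "p \<in> J \<Longrightarrow> q \<in> J \<Longrightarrow> p + q \<in> J" "p \<in> J \<Longrightarrow> q \<in> J \<Longrightarrow> p - q \<in> J"
    "p \<in> J \<Longrightarrow> q \<in> carrier (free_algebra I) \<Longrightarrow> q * p \<in> J"
    "p \<in> J \<Longrightarrow> q \<in> carrier (free_algebra I) \<Longrightarrow> p * q \<in> J"
    "p \<in> J \<Longrightarrow> fa_const c * p \<in> J"
    "p \<in> J \<Longrightarrow> p \<in> carrier (free_algebra I)"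
proof -
  interpret ideal J "free_algebra I" by fact
  show "0 \<in> J" using zero_closed by simp
  show "p + q \<in> J" if "p \<in> J" "q \<in> J" using a_closed[OF that] by simp
  show "p - q \<in> J" if "p \<in> J" "q \<in> J"
  proof -
    have "q \<in> carrier (free_algebra I)" using that(2) a_subset by blast
    then have "- q \<in> J" using a_inv_closed[OF that(2)] by simp
    then show ?thesis using a_closed[OF that(1)] by fastforce
  qed
  show "q * p \<in> J" if "p \<in> J" "q \<in> carrier (free_algebra I)" using I_l_closed[OF that] by simp
  show "p * q \<in> J" if "p \<in> J" "q \<in> carrier (free_algebra I)" using I_r_closed[OF that] by simp
  show "fa_const c * p \<in> J" if "p \<in> J"
    using I_l_closed[OF that, of "fa_const c"] by simp
  show "p \<in> carrier (free_algebra I)" if "p \<in> J" using that a_subset by auto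
qed

text \<open>
  Two substitutions that agree on the generators modulo an ideal agree modulo that ideal everywhere.
  On monomials this telescopes: the difference of the products \<open>f x * F\<close> and \<open>g x * G\<close> is
  \<open>(f x - g x) * F + g x * (F - G)\<close>.
\<close>

lemma fa_subst_cong_ideal:
  assumes p: "p \<in> carrier (free_algebra I)"
    and J: "ideal J (free_algebra K)"
    and f: "\<And>i. i \<in> I \<Longrightarrow> f i \<in> carrier (free_algebra K)"
    and g: "\<And>i. i \<in> I \<Longrightarrow> g i \<in> carrier (free_algebra K)"
    and fg: "\<And>i. i \<in> I \<Longrightarrow> f i - g i \<in> J"
  shows "fa_subst f p - fa_subst g p \<in> J"
  using p
proof (induction p rule: free_algebra_induct)
  case zero
  then show ?case using free_ideal_closed[OF J] by simp
next
  case (add p q)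
  then show ?case
    using free_ideal_closed(2)[OF J add.IH] by (simp add: algebra_simps)
next
  case (single xs c)
  then have "prod_list (map f xs) - prod_list (map g xs) \<in> J \<and>
      prod_list (map f xs) \<in> carrier (free_algebra K)"
  proof (induction xs)
    case (Cons x xs)
    let ?F = "prod_list (map f xs)" and ?G = "prod_list (map g xs)"
    have "(f x - g x) * ?F + g x * (?F - ?G) \<in> J"
      using Cons by (intro free_ideal_closed(2)[OF J] free_ideal_closed(4,5)[OF J] fg g) auto
    then show ?case using Cons f by (auto simp: algebra_simps)
  qed (simp add: free_ideal_closed[OF J])
  then show ?case
    using free_ideal_closed(6)[OF J, of "prod_list (map f xs) - prod_list (map g xs)" c]
    by (simp add: fa_subst_single algebra_simps)
qed

lemma relation_ideal:
  assumes "Rel \<subseteq> carrier (free_algebra I) \<times> carrier (free_algebra I)"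
  shows "ideal (relation_ideal I Rel) (free_algebra I)"
    and "(l, r) \<in> Rel \<Longrightarrow> l - r \<in> relation_ideal I Rel"
proof -
  have sub: "(\<lambda>(l, r). l - r) ` Rel \<subseteq> carrier (free_algebra I)"
    using assms by auto
  show "ideal (relation_ideal I Rel) (free_algebra I)"
    unfolding relation_ideal_def by (rule free.genideal_ideal[OF sub])
  show "l - r \<in> relation_ideal I Rel" if "(l, r) \<in> Rel"
    using free.genideal_self[OF sub] that unfolding relation_ideal_def by force
qed

text \<open>
  It suffices to check the defining relations: the preimage of an ideal under the substitution is an
  ideal, so it contains the ideal generated by any relations that it contains.
\<close>

lemma fa_subst_relation_ideal:
  assumes Rel: "Rel \<subseteq> carrier (free_algebra I) \<times> carrier (free_algebra I)"
    and J: "ideal J (free_algebra K)"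
    and f: "\<And>i. i \<in> I \<Longrightarrow> f i \<in> carrier (free_algebra K)"
    and rel: "\<And>l r. (l, r) \<in> Rel \<Longrightarrow> fa_subst f l - fa_subst f r \<in> J"
    and p: "p \<in> relation_ideal I Rel"
  shows "fa_subst f p \<in> J"
proof -
  have hom: "fa_subst f \<in> ring_hom (free_algebra I) (free_algebra K)"
    by (rule ring_hom_memI) (auto intro: fa_subst_closed f)
  interpret f: ring_hom_ring "free_algebra I" "free_algebra K" "fa_subst f"
    using free.ring_axioms free.ring_axioms hom by (rule ring_hom_ringI2)
  have "ideal {p \<in> carrier (free_algebra I). fa_subst f p \<in> J} (free_algebra I)"
    using f.ideal_vimage[OF J] by simp
  moreover have "(\<lambda>(l, r). l - r) ` Rel \<subseteq> {p \<in> carrier (free_algebra I). fa_subst f p \<in> J}"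
    using Rel rel by auto
  ultimately have "relation_ideal I Rel \<subseteq> {p \<in> carrier (free_algebra I). fa_subst f p \<in> J}"
    unfolding relation_ideal_def by (rule free.genideal_minimal)
  with p show ?thesis by auto
qed

text \<open>
  A Tietze transformation.  The substitutions \<open>f\<close> and \<open>g\<close> express each set of generators in terms of
  the other; being mutually inverse modulo the two ideals, they induce inverse isomorphisms of the
  presented algebras.  In the proof, \<open>f\<close> followed by the projection modulo the first ideal is
  surjective because \<open>f \<circ> g\<close> is the identity modulo that ideal, and its kernel is exactly the second
  ideal because \<open>g \<circ> f\<close> is the identity modulo the second ideal.
\<close>

lemma has_presentation_change_generators:
  fixes f :: "'j \<Rightarrow> 'i word \<Rightarrow>\<^sub>0 'k::field" and g :: "'i \<Rightarrow> 'j word \<Rightarrow>\<^sub>0 'k"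
  assumes RelI: "RelI \<subseteq> carrier (free_algebra I) \<times> carrier (free_algebra I)"
    and RelK: "RelK \<subseteq> carrier (free_algebra K) \<times> carrier (free_algebra K)"
    and f: "\<And>k. k \<in> K \<Longrightarrow> f k \<in> carrier (free_algebra I)"
    and g: "\<And>i. i \<in> I \<Longrightarrow> g i \<in> carrier (free_algebra K)"
    and f_rel: "\<And>l r. (l, r) \<in> RelK \<Longrightarrow> fa_subst f l - fa_subst f r \<in> relation_ideal I RelI"
    and g_rel: "\<And>l r. (l, r) \<in> RelI \<Longrightarrow> fa_subst g l - fa_subst g r \<in> relation_ideal K RelK"
    and fg: "\<And>i. i \<in> I \<Longrightarrow> fa_subst f (g i) - fa_gen i \<in> relation_ideal I RelI"
    and gf: "\<And>k. k \<in> K \<Longrightarrow> fa_subst g (f k) - fa_gen k \<in> relation_ideal K RelK"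
  shows "has_presentation (presented_algebra I RelI) K
    (\<lambda>k. relation_ideal I RelI +>\<^bsub>free_algebra I\<^esub> f k) RelK"
proof -
  let ?J = "relation_ideal I RelI" and ?L = "relation_ideal K RelK"
  let ?A = "free_algebra I :: ('k, 'i word \<Rightarrow>\<^sub>0 'k) module"
  let ?B = "free_algebra K :: ('k, 'j word \<Rightarrow>\<^sub>0 'k) module"
  note J = relation_ideal(1)[OF RelI] and L = relation_ideal(1)[OF RelK]
  interpret A: algebra_ideal ring_of_type_algebra ?A ?J
    using J by (rule algebra_ideal_free)
  interpret B: algebra_ideal ring_of_type_algebra ?B ?L
    using L by (rule algebra_ideal_free)
  let ?h = "\<lambda>p. ?J +>\<^bsub>?A\<^esub> fa_subst f p"
  have f_closed: "fa_subst f p \<in> carrier ?A" if "p \<in> carrier ?B" for p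
    using that f by (rule fa_subst_closed)
  have g_closed: "fa_subst g p \<in> carrier ?B" if "p \<in> carrier ?A" for p
    using that g by (rule fa_subst_closed)
  have fg_subst: "fa_subst f (fa_subst g p) - p \<in> ?J" if "p \<in> carrier ?A" for p
    using fa_subst_cong_ideal[OF that J, of "\<lambda>i. fa_subst f (g i)" fa_gen]
    by (simp add: f_closed g fg fa_subst_fa_subst fa_subst_fa_gen_id)
  have gf_subst: "fa_subst g (fa_subst f p) - p \<in> ?L" if "p \<in> carrier ?B" for p
    using fa_subst_cong_ideal[OF that L, of "\<lambda>k. fa_subst g (f k)" fa_gen]
    by (simp add: g_closed f gf fa_subst_fa_subst fa_subst_fa_gen_id)
  have hom: "?h \<in> ring_hom ?B (quotient_algebra ?A ?J)"
    by (rule ring_hom_memI) (auto simp: A.quotient_algebra_simps f_closed)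
  have smult: "?h (c \<odot>\<^bsub>?B\<^esub> p) = c \<odot>\<^bsub>quotient_algebra ?A ?J\<^esub> ?h p"
    if "p \<in> carrier ?B" for c p
    using that by (simp add: A.quotient_algebra_smult f_closed)
  have surj: "?h ` carrier ?B = carrier (quotient_algebra ?A ?J)"
  proof
    show "?h ` carrier ?B \<subseteq> carrier (quotient_algebra ?A ?J)"
      by (auto simp: A.quotient_algebra_simps f_closed)
    show "carrier (quotient_algebra ?A ?J) \<subseteq> ?h ` carrier ?B"
    proof
      fix U assume "U \<in> carrier (quotient_algebra ?A ?J)"
      then obtain p where p: "p \<in> carrier ?A" and U: "U = ?J +>\<^bsub>?A\<^esub> p"
        by (auto simp: A.quotient_algebra_simps)
      have "?h (fa_subst g p) = U"
        using fg_subst[OF p] p by (simp add: U A.coset_eq_iff f_closed g_closed)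
      then show "U \<in> ?h ` carrier ?B" using g_closed[OF p] by blast
    qed
  qed
  have kernel: "{p \<in> carrier ?B. ?h p = \<zero>\<^bsub>quotient_algebra ?A ?J\<^esub>} = ?L"
  proof (intro equalityI subsetI)
    fix p assume "p \<in> {p \<in> carrier ?B. ?h p = \<zero>\<^bsub>quotient_algebra ?A ?J\<^esub>}"
    then have p: "p \<in> carrier ?B" and "?h p = ?J"
      by (auto simp: A.quotient_algebra_simps)
    then have "fa_subst f p \<in> ?J" using A.rcos_const_imp_mem f_closed by blast
    then have "fa_subst g (fa_subst f p) \<in> ?L"
      using fa_subst_relation_ideal[OF RelI L g g_rel] by blast
    from free_ideal_closed(3)[OF L this gf_subst[OF p]] show "p \<in> ?L" by simp
  next
    fix p assume p: "p \<in> ?L"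
    then have "fa_subst f p \<in> ?J"
      using fa_subst_relation_ideal[OF RelK J f f_rel] by blast
    then show "p \<in> {p \<in> carrier ?B. ?h p = \<zero>\<^bsub>quotient_algebra ?A ?J\<^esub>}"
      using p free_ideal_closed(7)[OF L] by (simp add: A.quotient_algebra_simps A.a_rcos_const)
  qed
  obtain k where k: "k \<in> algebra_iso ring_of_type_algebra (quotient_algebra ?B ?L) (quotient_algebra ?A ?J)"
    and k_coset: "\<And>p. p \<in> carrier ?B \<Longrightarrow> k (?L +>\<^bsub>?B\<^esub> p) = ?h p"
    using B.quotient_algebra_iso[OF A.ring_quotient_algebra hom smult surj kernel] by blast
  have "k (presented_gen K RelK i) = ?J +>\<^bsub>?A\<^esub> f i" if "i \<in> K" for i
    using k_coset[of "fa_gen i"] that by (simp add: presented_gen_def)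
  with k RelK A.assoc_algebra_quotient_algebra show ?thesis
    unfolding has_presentation_def presented_algebra_def by blast
qed

section \<open>The affine change of generators for the Hecke algebra\<close>

definition calT_of :: "('i word \<Rightarrow>\<^sub>0 Cq) \<Rightarrow> 'i word \<Rightarrow>\<^sub>0 Cq"
  where "calT_of a = fa_const 2 * a - fa_const hecke_eps"

text \<open>The inverse of the substitution \<^const>\<open>calT_of\<close>.\<close>

definition T_of :: "('i word \<Rightarrow>\<^sub>0 Cq) \<Rightarrow> 'i word \<Rightarrow>\<^sub>0 Cq"
  where "T_of x = fa_const (1 / 2) * (x + fa_const hecke_eps)"

abbreviation quadratic :: "('i word \<Rightarrow>\<^sub>0 Cq) \<Rightarrow> 'i word \<Rightarrow>\<^sub>0 Cq"
  where "quadratic a \<equiv> (a - fa_const hecke_q) * (a + fa_const (inverse hecke_q))"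

lemma hecke_q_nonzero: "hecke_q \<noteq> 0"
  by (simp add: hecke_q_def Zero_fract_def eq_fract)

lemma two_nonzero: "(2 :: Cq) \<noteq> 0"
proof -
  have "(2 :: Cq) = of_nat 2" by simp
  also have "\<dots> = Fract 2 1" unfolding of_nat_fract by simp
  also have "\<dots> \<noteq> 0" by (simp add: Zero_fract_def eq_fract)
  finally show ?thesis .
qed

lemma fa_const_numeral: "fa_const (numeral m) = numeral m"
  by (simp add: fa_const_def)

lemma fa_const_times_fa_const: "fa_const c * (fa_const d * p) = fa_const (c * d) * p"
  by (simp add: fa_const_hom mult.assoc)

lemma calT_of_T_of: "calT_of (T_of x) = x"
  by (simp add: calT_of_def T_of_def fa_const_times_fa_const two_nonzero)

lemma T_of_calT_of: "T_of (calT_of x) = x"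
  by (simp add: calT_of_def T_of_def fa_const_times_fa_const two_nonzero)

text \<open>
  The computation behind the theorem, with \<open>s\<close>, \<open>t\<close>, \<open>e\<close> in the roles of the central elements \<open>q\<close>,
  \<open>q\<^sup>-\<^sup>1\<close>, \<open>\<epsilon>\<close>.  In the braid identity the cross terms \<open>e * (a * b + b * a)\<close> of the two
  triple products cancel.  Completing the squares \<open>a * a\<close> and \<open>b * b\<close> to the quadratic expressions
  leaves the linear terms \<open>2 * e\<^sup>2 * (b - a)\<close>, which the correction term of the relation removes.
\<close>

lemma ring_1_calT_identities:
  fixes a b s t e :: "'r::ring_1"
  assumes central: "\<And>x. x * s = s * x" "\<And>x. x * t = t * x" and st: "s * t = 1"
    and e: "e = s - t"
  shows "(2 * a - e)\<^sup>2 - (s\<^sup>2 + t\<^sup>2 + 2) = 4 * ((a - s) * (a + t))"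
    and "(2 * a - e) * (2 * b - e) - (2 * b - e) * (2 * a - e) = 4 * (a * b - b * a)"
    and "(2 * a - e) * (2 * b - e) * (2 * a - e) - (2 * b - e) * (2 * a - e) * (2 * b - e)
      - e\<^sup>2 * ((2 * b - e) - (2 * a - e)) =
      8 * (a * b * a - b * a * b) - 4 * (e * ((a - s) * (a + t))) + 4 * (e * ((b - s) * (b + t)))"
    and "a * (a - e) - 1 = (a - s) * (a + t)"
    and "(a - e) * a - 1 = (a - s) * (a + t)"
proof -
  have left: "x * (s * y) = s * (x * y)" "x * (t * y) = t * (x * y)" for x y
    by (simp_all only: central flip: mult.assoc)
  have ts: "t * s = 1" using central(2)[of s] st by simp
  have inv: "s * (t * x) = x" "t * (s * x) = x" for x
    by (simp_all add: st ts flip: mult.assoc)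
  have multiples: "2 * x = x + x" "4 * x = x + x + x + x"
    "8 * x = x + x + x + x + x + x + x + x" for x :: 'r
    using distrib_right[of 2 2 x] distrib_right[of 4 4 x] by (simp_all add: mult_2 add.assoc)
  \<comment> \<open>Normal form: central factors to the left, numeric multiples expanded into sums, so that
    the terms cancel in the additive group.\<close>
  note simps = e multiples power2_eq_square inv st ts
    central[of a] central[of b] left[of a] left[of b] algebra_simps
  show "(2 * a - e)\<^sup>2 - (s\<^sup>2 + t\<^sup>2 + 2) = 4 * ((a - s) * (a + t))"
    by (simp add: simps)
  show "(2 * a - e) * (2 * b - e) - (2 * b - e) * (2 * a - e) = 4 * (a * b - b * a)"
    by (simp add: simps)
  show "(2 * a - e) * (2 * b - e) * (2 * a - e) - (2 * b - e) * (2 * a - e) * (2 * b - e)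
      - e\<^sup>2 * ((2 * b - e) - (2 * a - e)) =
      8 * (a * b * a - b * a * b) - 4 * (e * ((a - s) * (a + t))) + 4 * (e * ((b - s) * (b + t)))"
    by (simp add: simps)
  show "a * (a - e) - 1 = (a - s) * (a + t)" "(a - e) * a - 1 = (a - s) * (a + t)"
    by (simp_all add: simps)
qed

lemma calT_of_identities:
  fixes a b :: "'i word \<Rightarrow>\<^sub>0 Cq"
  shows "(calT_of a)\<^sup>2 - fa_const (hecke_q\<^sup>2 + (inverse hecke_q)\<^sup>2 + 2) =
      fa_const 4 * quadratic a"
    and "calT_of a * calT_of b - calT_of b * calT_of a = fa_const 4 * (a * b - b * a)"
    and "calT_of a * calT_of b * calT_of a - calT_of b * calT_of a * calT_of b
        - fa_const (hecke_eps\<^sup>2) * (calT_of b - calT_of a) =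
      fa_const 8 * (a * b * a - b * a * b)
        - fa_const (4 * hecke_eps) * quadratic a + fa_const (4 * hecke_eps) * quadratic b"
    and "a * (a - fa_const hecke_eps) - 1 = quadratic a"
    and "(a - fa_const hecke_eps) * a - 1 = quadratic a"
proof -
  have unit: "fa_const hecke_q * fa_const (inverse hecke_q) = 1"
    using hecke_q_nonzero by (simp flip: fa_const_hom)
  have eps: "fa_const hecke_eps = fa_const hecke_q - fa_const (inverse hecke_q)"
    by (simp add: hecke_eps_def fa_const_hom)
  note identities = ring_1_calT_identities[OF fa_const_commute[symmetric]
      fa_const_commute[symmetric] unit eps]
  show "(calT_of a)\<^sup>2 - fa_const (hecke_q\<^sup>2 + (inverse hecke_q)\<^sup>2 + 2) = fa_const 4 * quadratic a"
    using identities(1)[of a]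
    by (simp add: calT_of_def fa_const_hom fa_const_numeral power2_eq_square)
  show "calT_of a * calT_of b - calT_of b * calT_of a = fa_const 4 * (a * b - b * a)"
    using identities(2)[of a b] by (simp add: calT_of_def fa_const_numeral)
  show "calT_of a * calT_of b * calT_of a - calT_of b * calT_of a * calT_of b
        - fa_const (hecke_eps\<^sup>2) * (calT_of b - calT_of a) =
      fa_const 8 * (a * b * a - b * a * b)
        - fa_const (4 * hecke_eps) * quadratic a + fa_const (4 * hecke_eps) * quadratic b"
    using identities(3)[of a b]
    by (simp add: calT_of_def fa_const_hom fa_const_numeral power2_eq_square mult.assoc)
  show "a * (a - fa_const hecke_eps) - 1 = quadratic a"
    "(a - fa_const hecke_eps) * a - 1 = quadratic a"
    by (rule identities(4), rule identities(5))
qed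

lemma fa_const_mult_mem_iff:
  assumes J: "ideal J (free_algebra I)" and c: "c \<noteq> 0"
  shows "fa_const c * p \<in> J \<longleftrightarrow> p \<in> J"
proof
  assume "fa_const c * p \<in> J"
  then have "fa_const (inverse c) * (fa_const c * p) \<in> J" by (rule free_ideal_closed(6)[OF J])
  then show "p \<in> J" using c by (simp add: fa_const_times_fa_const)
qed (rule free_ideal_closed(6)[OF J])

text \<open>
  The numerical factors 4 and 8 are invertible, so the identities turn into equivalences.  For the
  braid relations the quadratic relations are needed to absorb the two correction terms.
\<close>

lemma calT_of_relations_iff:
  fixes a b :: "'i word \<Rightarrow>\<^sub>0 Cq"
  assumes J: "ideal J (free_algebra I)"
  shows "(calT_of a)\<^sup>2 - fa_const (hecke_q\<^sup>2 + (inverse hecke_q)\<^sup>2 + 2) \<in> J \<longleftrightarrow> quadratic a \<in> J"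
    and "calT_of a * calT_of b - calT_of b * calT_of a \<in> J \<longleftrightarrow> a * b - b * a \<in> J"
    and "quadratic a \<in> J \<Longrightarrow> quadratic b \<in> J \<Longrightarrow>
      calT_of a * calT_of b * calT_of a - calT_of b * calT_of a * calT_of b
        - fa_const (hecke_eps\<^sup>2) * (calT_of b - calT_of a) \<in> J \<longleftrightarrow> a * b * a - b * a * b \<in> J"
proof -
  have "(4 :: Cq) = 2 * 2" "(8 :: Cq) = 2 * (2 * 2)" by simp_all
  then have nonzero: "(4 :: Cq) \<noteq> 0" "(8 :: Cq) \<noteq> 0"
    using two_nonzero by (metis mult_eq_0_iff)+
  show "(calT_of a)\<^sup>2 - fa_const (hecke_q\<^sup>2 + (inverse hecke_q)\<^sup>2 + 2) \<in> J \<longleftrightarrow> quadratic a \<in> J"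
    unfolding calT_of_identities(1) by (rule fa_const_mult_mem_iff[OF J nonzero(1)])
  show "calT_of a * calT_of b - calT_of b * calT_of a \<in> J \<longleftrightarrow> a * b - b * a \<in> J"
    unfolding calT_of_identities(2) by (rule fa_const_mult_mem_iff[OF J nonzero(1)])
  assume quad: "quadratic a \<in> J" "quadratic b \<in> J"
  define u where "u = fa_const (4 * hecke_eps) * quadratic a"
  define v where "v = fa_const (4 * hecke_eps) * quadratic b"
  have uv: "u \<in> J" "v \<in> J"
    unfolding u_def v_def using quad by (simp_all add: free_ideal_closed(6)[OF J])
  have "x - u + v \<in> J \<longleftrightarrow> x \<in> J" for x
    using free_ideal_closed(2)[OF J free_ideal_closed(3)[OF J _ uv(1)] uv(2), of x]
      free_ideal_closed(3)[OF J free_ideal_closed(2)[OF J _ uv(1)] uv(2), of "x - u + v"]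
    by auto
  then show "calT_of a * calT_of b * calT_of a - calT_of b * calT_of a * calT_of b
        - fa_const (hecke_eps\<^sup>2) * (calT_of b - calT_of a) \<in> J \<longleftrightarrow> a * b * a - b * a * b \<in> J"
    unfolding calT_of_identities(3) u_def[symmetric] v_def[symmetric]
    by (simp only: fa_const_mult_mem_iff[OF J nonzero(2)])
qed

lemma hecke_relations_carrier:
  "hecke_relations n \<subseteq> carrier (free_algebra {1..n - 1}) \<times> carrier (free_algebra {1..n - 1})"
  unfolding hecke_relations_def by auto

lemma calT_relations_carrier:
  "calT_relations n \<subseteq> carrier (free_algebra {1..n - 1}) \<times> carrier (free_algebra {1..n - 1})"
  unfolding calT_relations_def power2_eq_square by auto

lemma hecke_ideal:
  "ideal (relation_ideal {1..n - 1} (hecke_relations n)) (free_algebra {1..n - 1})"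
  by (rule relation_ideal(1)[OF hecke_relations_carrier])

lemma calT_ideal:
  "ideal (relation_ideal {1..n - 1} (calT_relations n)) (free_algebra {1..n - 1})"
  by (rule relation_ideal(1)[OF calT_relations_carrier])

lemma hecke_quadratic_mem:
  assumes "i \<in> {1..n - 1}"
  shows "quadratic (fa_gen i) \<in> relation_ideal {1..n - 1} (hecke_relations n)"
  using relation_ideal(2)[OF hecke_relations_carrier, of "quadratic (fa_gen i)" 0 n] assms
  by (auto simp: hecke_relations_def)

lemma calT_relations_hold_in_hecke:
  assumes "(l, r) \<in> calT_relations n"
  shows "fa_subst (\<lambda>i. calT_of (fa_gen i)) l - fa_subst (\<lambda>i. calT_of (fa_gen i)) r
    \<in> relation_ideal {1..n - 1} (hecke_relations n)"
proof -
  note J = calT_of_relations_iff[OF hecke_ideal]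
    and rel = relation_ideal(2)[OF hecke_relations_carrier]
  from assms consider
    (square) i where "i \<in> {1..n - 1}" "l = (fa_gen i)\<^sup>2"
      "r = fa_const (hecke_q\<^sup>2 + (inverse hecke_q)\<^sup>2 + 2)"
  | (commute) i j where "i \<in> {1..n - 1}" "j \<in> {1..n - 1}" "\<bar>int i - int j\<bar> > 1"
      "l = fa_gen i * fa_gen j" "r = fa_gen j * fa_gen i"
  | (braid) i where "i \<in> {1..n - 1}" "i + 1 \<in> {1..n - 1}"
      "l = fa_gen i * fa_gen (i + 1) * fa_gen i - fa_gen (i + 1) * fa_gen i * fa_gen (i + 1)"
      "r = fa_const (hecke_eps\<^sup>2) * (fa_gen (i + 1) - fa_gen i)"
    unfolding calT_relations_def by blast
  then show ?thesis
  proof cases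
    case square
    then show ?thesis using J(1) hecke_quadratic_mem by simp
  next
    case commute
    then have "fa_gen i * fa_gen j - fa_gen j * fa_gen i
        \<in> relation_ideal {1..n - 1} (hecke_relations n)"
      by (intro rel) (auto simp: hecke_relations_def)
    then show ?thesis using commute J(2) by simp
  next
    case braid
    then have "fa_gen i * fa_gen (i + 1) * fa_gen i - fa_gen (i + 1) * fa_gen i * fa_gen (i + 1)
        \<in> relation_ideal {1..n - 1} (hecke_relations n)"
      by (intro rel) (auto simp: hecke_relations_def)
    then show ?thesis
      using J(3)[OF hecke_quadratic_mem[OF braid(1)] hecke_quadratic_mem[OF braid(2)]]
      by (simp add: braid)
  qed
qed

text \<open>
  Here the equivalences are read at \<open>a = T_of x\<close>, for which \<open>calT_of a\<close> is \<open>x\<close> itself.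
\<close>

lemma hecke_relations_hold_in_calT:
  assumes "(l, r) \<in> hecke_relations n"
  shows "fa_subst (\<lambda>i. T_of (fa_gen i)) l - fa_subst (\<lambda>i. T_of (fa_gen i)) r
    \<in> relation_ideal {1..n - 1} (calT_relations n)"
proof -
  let ?J = "relation_ideal {1..n - 1} (calT_relations n)"
  note T_square_iff = calT_of_relations_iff(1)[OF calT_ideal, where a = "T_of a" for a,
      unfolded calT_of_T_of]
    and T_iff = calT_of_relations_iff(2,3)[OF calT_ideal, where a = "T_of a" and b = "T_of b" for a b,
      unfolded calT_of_T_of]
    and rel = relation_ideal(2)[OF calT_relations_carrier]
  have T_quadratic: "quadratic (T_of (fa_gen i)) \<in> ?J" if "i \<in> {1..n - 1}" for i
    using that by (subst T_square_iff[symmetric], intro rel) (auto simp: calT_relations_def)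
  from assms consider
    (quad) i where "i \<in> {1..n - 1}" "l = quadratic (fa_gen i)" "r = 0"
  | (braid) i where "i \<in> {1..n - 1}" "i + 1 \<in> {1..n - 1}"
      "l = fa_gen i * fa_gen (i + 1) * fa_gen i" "r = fa_gen (i + 1) * fa_gen i * fa_gen (i + 1)"
  | (commute) i j where "i \<in> {1..n - 1}" "j \<in> {1..n - 1}" "\<bar>int i - int j\<bar> > 1"
      "l = fa_gen i * fa_gen j" "r = fa_gen j * fa_gen i"
    unfolding hecke_relations_def by blast
  then show ?thesis
  proof cases
    case quad
    then show ?thesis using T_quadratic by simp
  next
    case commute
    then have "fa_gen i * fa_gen j - fa_gen j * fa_gen i \<in> ?J"
      by (intro rel) (auto simp: calT_relations_def)
    then show ?thesis using commute T_iff(1) by simp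
  next
    case braid
    then have "fa_gen i * fa_gen (i + 1) * fa_gen i - fa_gen (i + 1) * fa_gen i * fa_gen (i + 1)
        - fa_const (hecke_eps\<^sup>2) * (fa_gen (i + 1) - fa_gen i) \<in> ?J"
      by (intro rel) (auto simp: calT_relations_def)
    then show ?thesis
      using T_iff(2)[OF T_quadratic[OF braid(1)] T_quadratic[OF braid(2)]]
      by (simp add: braid)
  qed
qed

theorem proposition2p3:
  fixes n :: nat
  assumes "n \<ge> 1"
  shows "(\<forall>i \<in> {1..n - 1}.
            hecke_T n i \<in> Units (hecke_algebra n) \<and>
            hecke_calT n i =
              (2 \<odot>\<^bsub>hecke_algebra n\<^esub> hecke_T n i)
                \<ominus>\<^bsub>hecke_algebra n\<^esub> (hecke_eps \<odot>\<^bsub>hecke_algebra n\<^esub> \<one>\<^bsub>hecke_algebra n\<^esub>)) \<and>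
         has_presentation (hecke_algebra n) {1..n - 1} (hecke_calT n) (calT_relations n)"
proof -
  \<comment> \<open>The interval is kept opaque, since simplification would rewrite its endpoints.\<close>
  define I where "I = {1..n - 1}"
  let ?F = "free_algebra I :: (Cq, nat word \<Rightarrow>\<^sub>0 Cq) module"
  let ?J = "relation_ideal I (hecke_relations n)"
  let ?H = "hecke_algebra n"
  have H_def: "?H = quotient_algebra ?F ?J"
    by (simp add: hecke_algebra_def presented_algebra_def I_def)
  interpret J: algebra_ideal ring_of_type_algebra ?F ?J
    unfolding I_def by (rule algebra_ideal_free[OF hecke_ideal])
  interpret H: ring ?H
    unfolding H_def by (rule J.ring_quotient_algebra)
  note H_simps = J.quotient_algebra_simps J.quotient_algebra_smult J.quotient_algebra_minus
  have T: "hecke_T n i = ?J +>\<^bsub>?F\<^esub> fa_gen i" for i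
    by (simp add: hecke_T_def presented_gen_def I_def)
  have generator: "hecke_T n i \<in> Units ?H \<and>
      hecke_calT n i = (2 \<odot>\<^bsub>?H\<^esub> hecke_T n i) \<ominus>\<^bsub>?H\<^esub> (hecke_eps \<odot>\<^bsub>?H\<^esub> \<one>\<^bsub>?H\<^esub>) \<and>
      hecke_calT n i = ?J +>\<^bsub>?F\<^esub> calT_of (fa_gen i)" if i: "i \<in> I" for i
  proof -
    define x :: "nat word \<Rightarrow>\<^sub>0 Cq" where "x = fa_gen i"
    \<comment> \<open>The class of \<open>x - \<epsilon>\<close> is the inverse of \<open>T\<close>.\<close>
    define S where "S = ?J +>\<^bsub>?F\<^esub> (x - fa_const hecke_eps)"
    have x: "x \<in> carrier ?F" using i by (simp add: x_def)
    have Tx: "hecke_T n i = ?J +>\<^bsub>?F\<^esub> x" by (simp add: T x_def)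
    have TH: "hecke_T n i \<in> carrier ?H" and SH: "S \<in> carrier ?H"
      using x by (auto simp: Tx S_def H_def H_simps)
    have "quadratic x \<in> ?J" using hecke_quadratic_mem i unfolding x_def I_def by blast
    then have "x * (x - fa_const hecke_eps) - 1 \<in> ?J" "(x - fa_const hecke_eps) * x - 1 \<in> ?J"
      by (simp_all only: calT_of_identities)
    then have TS: "hecke_T n i \<otimes>\<^bsub>?H\<^esub> S = \<one>\<^bsub>?H\<^esub>" and ST: "S \<otimes>\<^bsub>?H\<^esub> hecke_T n i = \<one>\<^bsub>?H\<^esub>"
      using x by (simp_all add: Tx S_def H_def H_simps J.coset_eq_iff)
    have unit: "hecke_T n i \<in> Units ?H"
      using TH SH TS ST by (auto simp: Units_def)
    have "inv\<^bsub>?H\<^esub> (hecke_T n i) = S"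
      using TH SH TS ST by (rule H.inv_char)
    then have "hecke_calT n i = ?J +>\<^bsub>?F\<^esub> (x + (x - fa_const hecke_eps))"
      using x by (simp add: hecke_calT_def Tx S_def H_def H_simps)
    also have "x + (x - fa_const hecke_eps) = calT_of x"
      by (simp add: calT_of_def fa_const_numeral mult_2)
    finally have calT: "hecke_calT n i = ?J +>\<^bsub>?F\<^esub> calT_of x" .
    moreover have "(2 \<odot>\<^bsub>?H\<^esub> hecke_T n i) \<ominus>\<^bsub>?H\<^esub> (hecke_eps \<odot>\<^bsub>?H\<^esub> \<one>\<^bsub>?H\<^esub>) =
        ?J +>\<^bsub>?F\<^esub> calT_of x"
      using x by (simp add: Tx H_def H_simps calT_of_def)
    ultimately show ?thesis using unit by (simp add: x_def)
  qed
  have calT_closed: "calT_of p \<in> carrier ?F" and T_closed: "T_of p \<in> carrier ?F"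
    if "p \<in> carrier ?F" for p
    using that by (auto simp: calT_of_def T_of_def)
  have subst: "fa_subst f (calT_of p) = calT_of (fa_subst f p)"
    "fa_subst f (T_of p) = T_of (fa_subst f p)" for f :: "nat \<Rightarrow> nat word \<Rightarrow>\<^sub>0 Cq" and p
    by (simp_all add: calT_of_def T_of_def)
  note presentation_facts = hecke_relations_carrier[of n] calT_relations_carrier[of n]
    calT_relations_hold_in_hecke[of _ _ n] hecke_relations_hold_in_calT[of _ _ n]
    free_ideal_closed(1)[OF hecke_ideal[of n]] free_ideal_closed(1)[OF calT_ideal[of n]]
  have "has_presentation (presented_algebra I (hecke_relations n)) I
      (\<lambda>i. ?J +>\<^bsub>?F\<^esub> calT_of (fa_gen i)) (calT_relations n)"
    by (rule has_presentation_change_generators[where g = "\<lambda>i. T_of (fa_gen i)"])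
      (simp_all add: presentation_facts[folded I_def] calT_closed T_closed subst calT_of_T_of T_of_calT_of)
  moreover have "presented_algebra I (hecke_relations n) = ?H"
    by (simp add: hecke_algebra_def I_def)
  moreover have "hecke_calT n i = ?J +>\<^bsub>?F\<^esub> calT_of (fa_gen i)" if "i \<in> I" for i
    using generator[OF that] by blast
  ultimately have "has_presentation ?H I (hecke_calT n) (calT_relations n)"
    by (simp add: has_presentation_def)
  with generator show ?thesis unfolding I_def by blast
qed

end
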